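(* Let $d=(d_n)_{n\ge0}$ be a monotonic increasing, unbounded sequence of positive real numbers and let $a=(a_n)_{n\ge0}$ be a complex sequence with $a_0\neq0$ and $a_1\neq0$. If $T_a\in\mathcal B(h_d)$, then $T_a$ is not a compact operator.
   Context: All sequences are complex and indexed by $\mathbb N_0=\{0,1,2,\dots\}$. The weighted Hahn space is $h_d=\{x\in\mathbb C^{\mathbb N_0}:\sum_{n=0}^\infty d_n|x_n-x_{n+1}|<\infty,\ \lim_n x_n=0\}$ with norm $\|x\|_{h_d}=\sum_{n=0}^\infty d_n|x_n-x_{n+1}|$; it is a Banach space. The convolution is $(a*x)_n=\sum_{k=0}^n a_{n-k}x_k$, and $T_a(x)=a*x$. $\mathcal B(X)$ is the space of bounded linear operators on $X$. *)

theory Defs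
  imports "HOL-Analysis.Analysis"
begin

type_synonym cseq = "nat \<Rightarrow> complex"

definition hahn_space :: "(nat \<Rightarrow> real) \<Rightarrow> cseq set" where
  "hahn_space d = {x. summable (\<lambda>n. d n * norm (x n - x (Suc n))) \<and> x \<longlonglongrightarrow> 0}"

definition hahn_norm :: "(nat \<Rightarrow> real) \<Rightarrow> cseq \<Rightarrow> real" where
  "hahn_norm d x = (\<Sum>n. d n * norm (x n - x (Suc n)))"

definition seq_conv :: "cseq \<Rightarrow> cseq \<Rightarrow> cseq" where
  "seq_conv a x = (\<lambda>n. \<Sum>k\<le>n. a (n - k) * x k)"

text \<open>For a linear space \<open>X\<close> of sequences with norm \<open>N\<close>, an operator on \<open>X\<close> is a function on all
  sequences of which only the restriction to \<open>X\<close> matters.\<close>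

definition bounded_operators :: "cseq set \<Rightarrow> (cseq \<Rightarrow> real) \<Rightarrow> (cseq \<Rightarrow> cseq) set" where
  "bounded_operators X N =
    {T. (\<forall>x\<in>X. T x \<in> X) \<and>
        (\<forall>x\<in>X. \<forall>y\<in>X. T (\<lambda>n. x n + y n) = (\<lambda>n. T x n + T y n)) \<and>
        (\<forall>c. \<forall>x\<in>X. T (\<lambda>n. c * x n) = (\<lambda>n. c * T x n)) \<and>
        (\<exists>C. \<forall>x\<in>X. N (T x) \<le> C * N x)}"

text \<open>The locale \<open>Metric_space\<close> requires nonnegativity and symmetry on the whole type, whereas
  \<open>suminf\<close> is unspecified for divergent series; hence the value 0 outside \<open>X\<close>.\<close>

definition norm_dist :: "cseq set \<Rightarrow> (cseq \<Rightarrow> real) \<Rightarrow> cseq \<Rightarrow> cseq \<Rightarrow> real" where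
  "norm_dist X N x y = (if x \<in> X \<and> y \<in> X then N (\<lambda>n. x n - y n) else 0)"

abbreviation norm_topology :: "cseq set \<Rightarrow> (cseq \<Rightarrow> real) \<Rightarrow> cseq topology" where
  "norm_topology X N \<equiv> Metric_space.mtopology X (norm_dist X N)"

text \<open>Bounded sets are mapped to relatively compact sets.\<close>

definition compact_operator :: "cseq set \<Rightarrow> (cseq \<Rightarrow> real) \<Rightarrow> (cseq \<Rightarrow> cseq) \<Rightarrow> bool" where
  "compact_operator X N T \<longleftrightarrow>
    (\<forall>B. Metric_space.mbounded X (norm_dist X N) B \<longrightarrow>
      compactin (norm_topology X N) (norm_topology X N closure_of (T ` B)))"

lemma hahn_space_diff:
  assumes d: "\<And>n. d n > 0" and x: "x \<in> hahn_space d" and y: "y \<in> hahn_space d"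
  shows "(\<lambda>n. x n - y n) \<in> hahn_space d"
    and "hahn_norm d (\<lambda>n. x n - y n) \<le> hahn_norm d x + hahn_norm d y"
proof -
  have sx: "summable (\<lambda>n. d n * norm (x n - x (Suc n)))"
    and sy: "summable (\<lambda>n. d n * norm (y n - y (Suc n)))"
    and lx: "x \<longlonglongrightarrow> 0" and ly: "y \<longlonglongrightarrow> 0"
    using x y by (auto simp: hahn_space_def)
  have le: "d n * norm ((x n - y n) - (x (Suc n) - y (Suc n)))
      \<le> d n * norm (x n - x (Suc n)) + d n * norm (y n - y (Suc n))" for n
  proof -
    have "(x n - y n) - (x (Suc n) - y (Suc n)) = (x n - x (Suc n)) - (y n - y (Suc n))"
      by simp
    then have "norm ((x n - y n) - (x (Suc n) - y (Suc n)))
        \<le> norm (x n - x (Suc n)) + norm (y n - y (Suc n))"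
      by (simp only: norm_triangle_ineq4)
    then show ?thesis
      using mult_left_mono[OF _ less_imp_le[OF d[of n]]] by (simp add: distrib_left[symmetric])
  qed
  have s: "summable (\<lambda>n. d n * norm ((x n - y n) - (x (Suc n) - y (Suc n))))"
    using d by (intro summable_comparison_test'[OF summable_add[OF sx sy], of 0])
      (use le in \<open>simp add: abs_mult less_imp_le\<close>)
  then show "(\<lambda>n. x n - y n) \<in> hahn_space d"
    using tendsto_diff[OF lx ly] by (simp add: hahn_space_def)
  show "hahn_norm d (\<lambda>n. x n - y n) \<le> hahn_norm d x + hahn_norm d y"
    unfolding hahn_norm_def suminf_add[OF sx sy]
    by (rule suminf_le[OF le s summable_add[OF sx sy]])
qed

lemma hahn_norm_eq_0:
  assumes d: "\<And>n. d n > 0" and x: "x \<in> hahn_space d" and 0: "hahn_norm d x = 0"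
  shows "x = (\<lambda>n. 0)"
proof -
  have sx: "summable (\<lambda>n. d n * norm (x n - x (Suc n)))" and lx: "x \<longlonglongrightarrow> 0"
    using x by (auto simp: hahn_space_def)
  have "\<forall>n. d n * norm (x n - x (Suc n)) = 0"
    using 0 suminf_eq_zero_iff[OF sx] d by (simp add: hahn_norm_def less_imp_le)
  then have "x n - x (Suc n) = 0" for n
    using d[of n] by (auto dest!: spec[of _ n])
  then have c: "x n = x 0" for n
    by (induction n) auto
  have "x \<longlonglongrightarrow> x 0"
    by (rule Lim_transform_eventually[OF tendsto_const]) (simp add: c[symmetric])
  then have "x 0 = 0"
    using lx by (rule LIMSEQ_unique)
  then show ?thesis
    using c by (intro ext) simp
qed

lemma Metric_space_hahn:
  assumes d: "\<And>n. d n > 0"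
  shows "Metric_space (hahn_space d) (norm_dist (hahn_space d) (hahn_norm d))"
proof
  have com: "hahn_norm d (\<lambda>n. x n - y n) = hahn_norm d (\<lambda>n. y n - x n)" for x y
  proof -
    have "norm ((x n - y n) - (x (Suc n) - y (Suc n)))
        = norm ((y n - x n) - (y (Suc n) - x (Suc n)))" for n
      using norm_minus_cancel[of "(x n - y n) - (x (Suc n) - y (Suc n))"]
      by (simp add: algebra_simps)
    then show ?thesis by (simp add: hahn_norm_def)
  qed
  show "0 \<le> norm_dist (hahn_space d) (hahn_norm d) x y" for x y
  proof (cases "x \<in> hahn_space d \<and> y \<in> hahn_space d")
    case True
    then have "summable (\<lambda>n. d n * norm ((x n - y n) - (x (Suc n) - y (Suc n))))"
      using hahn_space_diff(1)[of d x y, OF d] unfolding hahn_space_def by blast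
    then have "0 \<le> hahn_norm d (\<lambda>n. x n - y n)"
      unfolding hahn_norm_def by (rule suminf_nonneg) (simp add: d less_imp_le)
    then show ?thesis by (simp add: norm_dist_def)
  qed (auto simp: norm_dist_def)
  show "norm_dist (hahn_space d) (hahn_norm d) x y = norm_dist (hahn_space d) (hahn_norm d) y x"
    for x y
    using com by (auto simp: norm_dist_def)
  show "norm_dist (hahn_space d) (hahn_norm d) x y = 0 \<longleftrightarrow> x = y"
    if "x \<in> hahn_space d" "y \<in> hahn_space d" for x y
  proof
    assume "norm_dist (hahn_space d) (hahn_norm d) x y = 0"
    then have "(\<lambda>n. x n - y n) = (\<lambda>n. 0)"
      using that hahn_norm_eq_0[of d "\<lambda>n. x n - y n", OF d] hahn_space_diff(1)[of d x y, OF d]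
      by (simp add: norm_dist_def)
    then have "x n - y n = 0" for n
      by (rule fun_cong)
    then show "x = y"
      by (intro ext) simp
  next
    assume "x = y"
    then show "norm_dist (hahn_space d) (hahn_norm d) x y = 0"
      by (simp add: norm_dist_def hahn_norm_def)
  qed
  show "norm_dist (hahn_space d) (hahn_norm d) x z
      \<le> norm_dist (hahn_space d) (hahn_norm d) x y + norm_dist (hahn_space d) (hahn_norm d) y z"
    if "x \<in> hahn_space d" "y \<in> hahn_space d" "z \<in> hahn_space d" for x y z
  proof -
    have "hahn_norm d (\<lambda>n. (x n - y n) - (z n - y n))
        \<le> hahn_norm d (\<lambda>n. x n - y n) + hahn_norm d (\<lambda>n. z n - y n)"
      using that d by (intro hahn_space_diff)
    then show ?thesis
      using that com[of z y] by (simp add: norm_dist_def)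
  qed
qed

end

theory Submission imports Defs begin

text \<open>The normalised sections \<open>y\<^sub>k = (1/d\<^sub>k, \<dots>, 1/d\<^sub>k, 0, 0, \<dots>)\<close> lie on the unit sphere of \<open>h\<^sub>d\<close>.
  Consecutive differences of \<open>a * y\<^sub>k\<close> at a fixed index are eventually \<open>- a\<^sub>n\<^sub>+\<^sub>1 / d\<^sub>k\<close> and tend to 0, so a
  norm limit of a subsequence of \<open>(a * y\<^sub>k)\<close> must be 0. But the difference at index \<open>k\<close> is
  \<open>(a\<^sub>0 - a\<^sub>k\<^sub>+\<^sub>1) / d\<^sub>k\<close>, which has weight \<open>d\<^sub>k\<close> in the norm; since \<open>a\<close> is a multiple of \<open>a * y\<^sub>0 \<in> h\<^sub>d\<close>, it is
  a null sequence, and so the norms stay close to at least \<open>\<bar>a\<^sub>0\<bar> > 0\<close>.\<close>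

definition section_unit :: "(nat \<Rightarrow> real) \<Rightarrow> nat \<Rightarrow> cseq" where
  "section_unit d k = (\<lambda>n. if n \<le> k then 1 / of_real (d k) else 0)"

lemma section_unit_diff:
  "section_unit d k n - section_unit d k (Suc n) = (if n = k then 1 / of_real (d k) else 0)"
  by (auto simp: section_unit_def)

lemma section_unit_sums:
  assumes "d k > 0"
  shows "(\<lambda>n. d n * norm (section_unit d k n - section_unit d k (Suc n))) sums 1"
proof -
  have "(\<lambda>n. d n * norm (section_unit d k n - section_unit d k (Suc n)))
      = (\<lambda>n. if n = k then 1 else 0)"
    using assms by (auto simp: section_unit_diff norm_divide)
  then show ?thesis
    using sums_single[of k "\<lambda>_. 1 :: real"] by simp
qed

lemma section_unit_in_hahn_space:
  assumes "d k > 0"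
  shows "section_unit d k \<in> hahn_space d"
proof -
  have "section_unit d k \<longlonglongrightarrow> 0"
    by (rule tendsto_eventually)
      (auto simp: section_unit_def eventually_sequentially intro!: exI[of _ "Suc k"])
  then show ?thesis
    using section_unit_sums[of d k, OF assms] by (auto simp: hahn_space_def sums_iff)
qed

lemma hahn_norm_section_unit: "d k > 0 \<Longrightarrow> hahn_norm d (section_unit d k) = 1"
  using section_unit_sums[of d k] by (simp add: hahn_norm_def sums_iff)

text \<open>Used for balls centred at 0: the distance from the zero sequence to \<open>x\<close> is
  the norm of \<open>0 - x\<close>.\<close>

lemma hahn_norm_uminus: "hahn_norm d (\<lambda>n. - x n) = hahn_norm d x"
proof -
  have "norm (- x n - - x (Suc n)) = norm (x n - x (Suc n))" for n
    by (simp add: norm_minus_commute)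
  then show ?thesis
    by (simp add: hahn_norm_def)
qed

text \<open>A series with nonnegative terms dominates each of them; norm convergence thus controls
  the weighted difference at every index.\<close>

lemma hahn_norm_ge_term:
  assumes "\<And>n. d n > 0" and "x \<in> hahn_space d"
  shows "d n * norm (x n - x (Suc n)) \<le> hahn_norm d x"
proof -
  have "summable (\<lambda>n. d n * norm (x n - x (Suc n)))"
    using assms(2) by (simp add: hahn_space_def)
  from sum_le_suminf[OF this, of "{n}"] show ?thesis
    using assms(1) by (simp add: hahn_norm_def less_imp_le)
qed

lemma zero_in_hahn_space: "(\<lambda>n. 0) \<in> hahn_space d"
  by (simp add: hahn_space_def)

lemma mbounded_section_units:
  assumes d: "\<And>n. d n > 0"
  shows "Metric_space.mbounded (hahn_space d) (norm_dist (hahn_space d) (hahn_norm d))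
    (range (section_unit d))"
proof -
  interpret Metric_space "hahn_space d" "norm_dist (hahn_space d) (hahn_norm d)"
    using d by (rule Metric_space_hahn)
  have "range (section_unit d) \<subseteq> mcball (\<lambda>n. 0) 1"
    using d by (auto simp: in_mcball norm_dist_def zero_in_hahn_space section_unit_in_hahn_space
        hahn_norm_uminus hahn_norm_section_unit)
  then show ?thesis
    unfolding mbounded_def by blast
qed

text \<open>Splitting off the term of index 0 from the longer sum and shifting the rest gives both
  sums the coefficients \<open>a (n - j)\<close>. For a section, the differences of \<open>x\<close>
  form a single spike.\<close>

lemma seq_conv_diff:
  "seq_conv a x n - seq_conv a x (Suc n)
    = (\<Sum>j\<le>n. a (n - j) * (x j - x (Suc j))) - a (Suc n) * x 0"
  by (simp add: seq_conv_def sum.atMost_Suc_shift sum_subtractf right_diff_distrib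
      del: sum.atMost_Suc)

text \<open>The spike at \<open>k\<close> contributes only if \<open>k \<le> n\<close>; the term
  with \<open>a (Suc n)\<close> is the boundary term and is present for every
  \<open>n\<close>.\<close>

lemma seq_conv_section_unit_diff:
  "seq_conv a (section_unit d k) n - seq_conv a (section_unit d k) (Suc n)
    = ((if k \<le> n then a (n - k) else 0) - a (Suc n)) / of_real (d k)"
proof -
  have "(\<Sum>j\<le>n. a (n - j) * (section_unit d k j - section_unit d k (Suc j)))
      = (\<Sum>j\<le>n. if j = k then a (n - k) / of_real (d k) else 0)"
    by (rule sum.cong) (auto simp: section_unit_diff)
  also have "\<dots> = (if k \<le> n then a (n - k) / of_real (d k) else 0)"
    by simp
  finally show ?thesis
    by (simp add: seq_conv_diff section_unit_def diff_divide_distrib)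
qed

text \<open>Recovers \<open>a\<close>, up to a scalar, from the image of one element of the
  space.\<close>

lemma seq_conv_section_unit_0: "seq_conv a (section_unit d 0) n = a n / of_real (d 0)"
proof -
  have "seq_conv a (section_unit d 0) n = (\<Sum>j\<le>n. if j = 0 then a n / of_real (d 0) else 0)"
    unfolding seq_conv_def by (rule sum.cong) (auto simp: section_unit_def)
  then show ?thesis
    by simp
qed

theorem corollary4p8:
  fixes d :: "nat \<Rightarrow> real" and a :: "nat \<Rightarrow> complex"
  assumes "\<And>n. d n > 0"
    and "incseq d"
    and "\<not> bdd_above (range d)"
    and "a 0 \<noteq> 0"
    and "a 1 \<noteq> 0"
    and "seq_conv a \<in> bounded_operators (hahn_space d) (hahn_norm d)"
  shows "\<not> compact_operator (hahn_space d) (hahn_norm d) (seq_conv a)"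
proof
  assume cpt: "compact_operator (hahn_space d) (hahn_norm d) (seq_conv a)"
  let ?X = "hahn_space d"
  interpret Metric_space ?X "norm_dist ?X (hahn_norm d)"
    using assms(1) by (rule Metric_space_hahn)
  define f where "f k = seq_conv a (section_unit d k)" for k
  let ?F = "seq_conv a ` range (section_unit d)"
  have fX: "f k \<in> ?X" for k
    using assms(1,6) by (auto simp: f_def bounded_operators_def section_unit_in_hahn_space)
  have "compactin mtopology (mtopology closure_of ?F)"
    using cpt mbounded_section_units[of d] assms(1) unfolding compact_operator_def by blast
  moreover have "range f \<subseteq> mtopology closure_of ?F"
    using closure_of_subset[of ?F mtopology] fX by (auto simp: f_def)
  ultimately obtain l r where r: "strict_mono r"
    and lim: "limitin mtopology (f \<circ> r) l sequentially"
    unfolding compactin_sequentially by blast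
  have lX: "l \<in> ?X"
    and dist0: "(\<lambda>k. norm_dist ?X (hahn_norm d) (f (r k)) l) \<longlonglongrightarrow> 0"
    using lim by (auto simp: limitin_metric_dist_null o_def)
  define e where "e k = hahn_norm d (\<lambda>n. f (r k) n - l n)" for k
  have e0: "e \<longlonglongrightarrow> 0"
    using dist0 fX lX by (simp add: e_def[abs_def] norm_dist_def)
  \<comment> \<open>The bound is uniform in \<open>n\<close>: it serves both for fixed
    \<open>n\<close> and for the moving index \<open>n = r k\<close>.\<close>
  have e_ge: "d n * norm ((f (r k) n - l n) - (f (r k) (Suc n) - l (Suc n))) \<le> e k" for n k
    using hahn_norm_ge_term[OF assms(1) hahn_space_diff(1)[OF assms(1) fX lX]] by (simp add: e_def)
  have "filterlim d at_top sequentially"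
    unfolding filterlim_at_top eventually_sequentially
  proof
    fix Z
    obtain N where "Z \<le> d N"
      using assms(3) unfolding bdd_above_def by (metis nle_le rangeE)
    then show "\<exists>N. \<forall>n\<ge>N. Z \<le> d n"
      using assms(2) by (meson incseqD order_trans)
  qed
  then have "filterlim (\<lambda>k. d (r k)) at_top sequentially"
    by (rule filterlim_compose) (rule filterlim_subseq[OF r])
  then have inv0: "(\<lambda>k. inverse (d (r k))) \<longlonglongrightarrow> 0"
    by (rule tendsto_inverse_0_at_top)
  \<comment> \<open>That the limit is 0 is expressed by vanishing differences, the form in which
    \<open>l\<close> enters the norm.\<close>
  have l_diff: "l n - l (Suc n) = 0" for n
  proof -
    have "\<forall>\<^sub>F k in sequentially.
        - a (Suc n) * of_real (inverse (d (r k))) = f (r k) n - f (r k) (Suc n)"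
    proof (rule eventually_sequentiallyI[of "Suc n"])
      fix k assume "Suc n \<le> k"
      then have "\<not> r k \<le> n"
        using seq_suble[OF r, of k] by simp
      then show "- a (Suc n) * of_real (inverse (d (r k))) = f (r k) n - f (r k) (Suc n)"
        by (simp add: f_def seq_conv_section_unit_diff field_simps)
    qed
    moreover have "(\<lambda>k. - a (Suc n) * of_real (inverse (d (r k)))) \<longlonglongrightarrow> 0"
      using tendsto_mult[OF tendsto_const[of "- a (Suc n)"] tendsto_of_real[OF inv0]] by simp
    ultimately have f0: "(\<lambda>k. f (r k) n - f (r k) (Suc n)) \<longlonglongrightarrow> 0"
      by (rule Lim_transform_eventually[rotated])
    have "(\<lambda>k. (f (r k) n - l n) - (f (r k) (Suc n) - l (Suc n))) \<longlonglongrightarrow> 0"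
    proof (rule Lim_null_comparison)
      show "\<forall>\<^sub>F k in sequentially.
          norm ((f (r k) n - l n) - (f (r k) (Suc n) - l (Suc n))) \<le> e k / d n"
        using e_ge[of n] assms(1)[of n] by (simp add: pos_le_divide_eq mult.commute)
      show "(\<lambda>k. e k / d n) \<longlonglongrightarrow> 0"
        using tendsto_divide[OF e0 tendsto_const[of "d n"]] assms(1)[of n] by simp
    qed
    from tendsto_diff[OF f0 this] have "(\<lambda>k::nat. l n - l (Suc n)) \<longlonglongrightarrow> 0"
      by (simp add: algebra_simps)
    then show ?thesis
      by (simp add: LIMSEQ_const_iff)
  qed
  \<comment> \<open>At index \<open>r k\<close> the weight \<open>d (r k)\<close> cancels the
    normalising factor exactly, so the bound does not decay with \<open>1 / d (r k)\<close>.\<close>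
  have "norm (a 0 - a (Suc (r k))) \<le> e k" for k
  proof -
    have "(f (r k) (r k) - l (r k)) - (f (r k) (Suc (r k)) - l (Suc (r k)))
        = (f (r k) (r k) - f (r k) (Suc (r k))) - (l (r k) - l (Suc (r k)))"
      by simp
    also have "\<dots> = (a 0 - a (Suc (r k))) / of_real (d (r k))"
      unfolding l_diff f_def seq_conv_section_unit_diff by simp
    finally show ?thesis
      using e_ge[of "r k" k] assms(1)[of "r k"] by (simp add: norm_divide)
  qed
  then have "(\<lambda>k. a 0 - a (Suc (r k))) \<longlonglongrightarrow> 0"
    using e0 by (intro Lim_null_comparison[of "\<lambda>k. a 0 - a (Suc (r k))" e] always_eventually allI)
  moreover have "(\<lambda>k. a 0 - a (Suc (r k))) \<longlonglongrightarrow> a 0 - 0"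
  proof -
    \<comment> \<open>Elements of the space tend to 0; applied to \<open>f 0\<close>, this makes
      \<open>a\<close> a null sequence.\<close>
    have "(\<lambda>n. of_real (d 0) * f 0 n) \<longlonglongrightarrow> of_real (d 0) * 0"
      using fX[of 0] by (intro tendsto_mult tendsto_const) (simp add: hahn_space_def)
    moreover have "of_real (d 0) * f 0 n = a n" for n
      using assms(1)[of 0] by (simp add: f_def seq_conv_section_unit_0)
    ultimately have "a \<longlonglongrightarrow> 0"
      by simp
    then have "(\<lambda>k. a (Suc (r k))) \<longlonglongrightarrow> 0"
      using LIMSEQ_subseq_LIMSEQ[OF LIMSEQ_Suc r, of a 0] by (simp add: o_def)
    then show ?thesis
      by (intro tendsto_diff tendsto_const)
  qed
  ultimately have "a 0 = 0"
    using LIMSEQ_unique[of _ 0 "a 0 - 0"] by simp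
  with assms(4) show False
    by contradiction
qed

end
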